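(* Let $U = \{z \in \mathbb{C} : |z| < 1\}$ and let $g : U \to \mathbb{C}$ be an analytic univalent function with Taylor series representation $$g(z) = \sum_{n=0}^{\infty} b_n z^n, \quad z \in U.$$ If the coefficients $a_0, a_1, \ldots \in \mathbb{C}$ satisfy the inequality $$\sum_{n=1}^{\infty} n\,|a_n - b_n| < K(g, U),$$ then the function $f : U \to \mathbb{C}$ defined by $$f(z) = \sum_{n=0}^{\infty} a_n z^n, \quad z \in U,$$ is (well defined,) analytic and univalent in $U$.
   Context: A function is univalent in a domain if it is analytic and injective there. For an analytic function $h : D \to \mathbb{C}$ in a domain $D \subset \mathbb{C}$, define $$K(h, D) = \inf_{\substack{a, b \in D \\ a \neq b}} \left| \frac{h(a) - h(b)}{a - b} \right|.$$ *)

theory Defs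
  imports "HOL-Analysis.Analysis"
begin

(* Both notions are meant for D a domain (open and connected); D is left as a bare set here,
   so openness and connectedness are the business of the user. *)

definition univalent_on :: "(complex \<Rightarrow> complex) \<Rightarrow> complex set \<Rightarrow> bool" where
  "univalent_on h D \<longleftrightarrow> h analytic_on D \<and> inj_on h D"

(* A real infimum: the set is bounded below by 0, and it is nonempty as soon as D has two points,
   which every nonempty domain does. *)
definition K :: "(complex \<Rightarrow> complex) \<Rightarrow> complex set \<Rightarrow> real" where
  "K h D = Inf {norm ((h a - h b) / (a - b)) | a b. a \<in> D \<and> b \<in> D \<and> a \<noteq> b}"

end

theory Submission
  imports Defs
begin

text \<open>The coefficient differences define a function that is Lipschitz on the unit disc with
  constant \<open>\<Sum> n |a n - b n|\<close>, because \<open>|x^n - y^n| \<le> n |x - y|\<close> there. As this constant is less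
  than \<open>K g U\<close>, adding that function to \<open>g\<close> cannot make two values of \<open>g\<close> coincide.\<close>

text \<open>Clearing the denominator in the quotients turns the infimum into a lower Lipschitz bound
  for \<open>h\<close>. An infimum of a set bounded below by 0 is at most each member, and for
  \<open>x = y\<close> both sides vanish.\<close>

lemma K_mult_le:
  assumes "x \<in> D" "y \<in> D"
  shows "K h D * norm (x - y) \<le> norm (h x - h y)"
proof (cases "x = y")
  case False
  let ?Q = "{norm ((h a - h b) / (a - b)) | a b. a \<in> D \<and> b \<in> D \<and> a \<noteq> b}"
  have "bdd_below ?Q"
    by (rule bdd_belowI[of _ 0]) auto
  moreover have "norm ((h x - h y) / (x - y)) \<in> ?Q"
    using assms False by blast
  ultimately have "K h D \<le> norm ((h x - h y) / (x - y))"
    unfolding K_def by (rule cInf_lower[rotated])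
  with False show ?thesis
    by (simp add: norm_divide field_simps)
qed auto

text \<open>Since \<open>norm z \<le> 1\<close> and \<open>Suc n \<ge> 1\<close>, each term of
  positive index is dominated by the corresponding term of the hypothesis; the term of index 0 does
  not affect convergence.\<close>

lemma summable_power_series_of_summable_deriv_coeffs:
  fixes d :: "nat \<Rightarrow> complex"
  assumes d: "summable (\<lambda>n. real (Suc n) * norm (d (Suc n)))" and z: "norm z \<le> 1"
  shows "summable (\<lambda>n. d n * z ^ n)"
proof -
  have "summable (\<lambda>n. d (Suc n) * z ^ Suc n)"
  proof (rule summable_comparison_test'[OF d])
    fix n :: nat
    have "norm (d (Suc n) * z ^ Suc n) \<le> norm (d (Suc n)) * 1"
      unfolding norm_mult norm_power by (intro mult_left_mono power_le_one z) auto
    also have "\<dots> \<le> real (Suc n) * norm (d (Suc n))"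
      by (simp add: distrib_right)
    finally show "norm (d (Suc n) * z ^ Suc n) \<le> real (Suc n) * norm (d (Suc n))" .
  qed
  then show ?thesis
    by (subst (asm) summable_Suc_iff)
qed

lemma power_series_lipschitz_unit_disc:
  fixes d :: "nat \<Rightarrow> complex"
  assumes d: "summable (\<lambda>n. real (Suc n) * norm (d (Suc n)))"
    and x: "norm x \<le> 1" and y: "norm y \<le> 1"
  shows "norm ((\<Sum>n. d n * x ^ n) - (\<Sum>n. d n * y ^ n))
    \<le> (\<Sum>n. real (Suc n) * norm (d (Suc n))) * norm (x - y)"
proof -
  let ?t = "\<lambda>n. d n * x ^ n - d n * y ^ n"
  have sx: "summable (\<lambda>n. d n * x ^ n)" and sy: "summable (\<lambda>n. d n * y ^ n)"
    using summable_power_series_of_summable_deriv_coeffs[OF d] x y by auto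
  have "(\<Sum>n. d n * x ^ n) - (\<Sum>n. d n * y ^ n) = (\<Sum>n. ?t n)"
    by (rule suminf_diff[OF sx sy])
  \<comment> \<open>The constant terms cancel, as \<open>x ^ 0 = y ^ 0\<close>, so the value of
    \<open>d 0\<close> does not enter the bound.\<close>
  also have "\<dots> = (\<Sum>n. ?t (Suc n))"
    using suminf_split_head[OF summable_diff[OF sx sy]] by simp
  also have "norm \<dots> \<le> (\<Sum>n. real (Suc n) * norm (d (Suc n)) * norm (x - y))"
  proof (rule norm_suminf_le)
    fix n
    have "norm (?t (Suc n)) = norm (d (Suc n)) * norm (x ^ Suc n - y ^ Suc n)"
      by (simp only: right_diff_distrib[symmetric] norm_mult)
    also have "\<dots> \<le> norm (d (Suc n)) * (real (Suc n) * norm (x - y))"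
      by (intro mult_left_mono norm_power_diff x y) auto
    finally show "norm (?t (Suc n)) \<le> real (Suc n) * norm (d (Suc n)) * norm (x - y)"
      by (simp only: mult_ac)
  qed (rule summable_mult2[OF d])
  also have "\<dots> = (\<Sum>n. real (Suc n) * norm (d (Suc n))) * norm (x - y)"
    by (rule suminf_mult2[OF d, symmetric])
  finally show ?thesis .
qed

theorem theorem2p11:
  fixes g :: "complex \<Rightarrow> complex" and a b :: "nat \<Rightarrow> complex"
  assumes "univalent_on g (ball 0 1)"
    and "\<And>z. z \<in> ball 0 1 \<Longrightarrow> (\<lambda>n. b n * z ^ n) sums g z"
    and "summable (\<lambda>n. real (Suc n) * norm (a (Suc n) - b (Suc n)))"
    and "(\<Sum>n. real (Suc n) * norm (a (Suc n) - b (Suc n))) < K g (ball 0 1)"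
  shows "(\<forall>z\<in>ball 0 1. summable (\<lambda>n. a n * z ^ n)) \<and>
         univalent_on (\<lambda>z. \<Sum>n. a n * z ^ n) (ball 0 1)"
proof -
  let ?f = "\<lambda>z. \<Sum>n. a n * z ^ n"
  let ?h = "\<lambda>z. \<Sum>n. (a n - b n) * z ^ n"
  \<comment> \<open>Writing \<open>a n = b n + (a n - b n)\<close> gives at once convergence of the
    series of \<open>?f\<close> and the decomposition of \<open>?f\<close> as \<open>g\<close> plus
    the perturbation \<open>?h\<close>.\<close>
  have "(\<lambda>n. a n * z ^ n) sums (g z + ?h z)" if "z \<in> ball 0 1" for z
  proof -
    have "summable (\<lambda>n. (a n - b n) * z ^ n)"
      using that by (intro summable_power_series_of_summable_deriv_coeffs assms(3)) auto
    from sums_add[OF assms(2)[OF that] summable_sums[OF this]] show ?thesis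
      by (simp add: algebra_simps)
  qed
  then have sum_f: "summable (\<lambda>n. a n * z ^ n)" and f_eq: "?f z = g z + ?h z"
    if "z \<in> ball 0 1" for z
    using that by (auto simp: sums_iff)
  have "?f field_differentiable at z" if "z \<in> ball 0 1" for z
  proof -
    \<comment> \<open>Convergence throughout the open disc permits termwise differentiation. The
      \<open>K\<close> instantiated here is the radius in the rule, not the infimum
      \<open>K\<close>.\<close>
    have "(?f has_field_derivative (\<Sum>n. diffs a n * z ^ n)) (at z)"
      using that sum_f by (intro termdiffs_strong'[where K = 1]) auto
    then show ?thesis
      by (auto simp: field_differentiable_def)
  qed
  then have "?f analytic_on ball 0 1"
    by (simp add: analytic_on_open holomorphic_on_def field_differentiable_at_within)
  moreover have "inj_on ?f (ball 0 1)"
  proof (rule inj_onI, rule ccontr)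
    fix x y :: complex
    assume x: "x \<in> ball 0 1" and y: "y \<in> ball 0 1" and eq: "?f x = ?f y" and "x \<noteq> y"
    have "g x + ?h x = g y + ?h y"
      using eq f_eq[OF x] f_eq[OF y] by (simp only:)
    then have "g x - g y = - (?h x - ?h y)"
      by (simp only: minus_diff_eq diff_eq_eq diff_add_eq eq_diff_eq add.commute)
    then have "norm (g x - g y) = norm (?h x - ?h y)"
      by (simp only: norm_minus_cancel)
    also have "\<dots> \<le> (\<Sum>n. real (Suc n) * norm (a (Suc n) - b (Suc n))) * norm (x - y)"
      using x y by (intro power_series_lipschitz_unit_disc assms(3)) auto
    \<comment> \<open>Strictness survives the multiplication because \<open>norm (x - y)\<close> is
      positive; the chain then returns to \<open>norm (g x - g y)\<close>, where it began.\<close>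
    also have "\<dots> < K g (ball 0 1) * norm (x - y)"
      using assms(4) \<open>x \<noteq> y\<close> by (intro mult_strict_right_mono) auto
    also have "\<dots> \<le> norm (g x - g y)"
      using x y by (rule K_mult_le)
    finally show False
      by simp
  qed
  ultimately show ?thesis
    using sum_f by (auto simp: univalent_on_def)
qed

end
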